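(* There exists a Heron triangle all three of whose side lengths are perfect squares (of positive integers) if and only if the Diophantine equation \[ q^4 = r^4 - \frac{4k}{k^2+1}\,r^2 + 1 \] has a non-trivial rational solution $(k,r,q)\in\mathbb{Q}^3$ with $0<k<1$ and $r\neq 0$.
   Context: A Heron triangle is a (non-degenerate) triangle whose three side lengths and whose area are all positive integers. For this equation, the trivial rational solutions are those with $r=0$ (which force $q=\pm 1$); a non-trivial solution is one that is not of this form. *)

theory Defs
  imports "HOL-Analysis.Analysis"
begin

definition pos_ints :: "real set" where
  "pos_ints = {real n | n::nat. n > 0}"

definition pos_int_squares :: "real set" where
  "pos_int_squares = {real (n\<^sup>2) | n::nat. n > 0}"

definition heron_triangle :: "real ^ 2 \<Rightarrow> real ^ 2 \<Rightarrow> real ^ 2 \<Rightarrow> bool" where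
  "heron_triangle A B C \<longleftrightarrow>
     \<not> collinear {A, B, C} \<and>
     dist B C \<in> pos_ints \<and> dist C A \<in> pos_ints \<and> dist A B \<in> pos_ints \<and>
     measure lborel (convex hull {A, B, C}) \<in> pos_ints"

definition quartic_solution :: "rat \<Rightarrow> rat \<Rightarrow> rat \<Rightarrow> bool" where
  "quartic_solution k r q \<longleftrightarrow> q ^ 4 = r ^ 4 - 4 * k / (k\<^sup>2 + 1) * r\<^sup>2 + 1"

(* For a solution, r = 0 already forces q = 1 or q = -1, so q need not be mentioned. *)
definition trivial_solution :: "rat \<Rightarrow> rat \<Rightarrow> rat \<Rightarrow> bool" where
  "trivial_solution k r q \<longleftrightarrow> quartic_solution k r q \<and> r = 0"

end

theory Submission
  imports Defs
begin

text \<open>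
  If a triangle has sides \<open>x\<^sup>2\<close>, \<open>y\<^sup>2\<close>, \<open>z\<^sup>2\<close> and the angle between the first two has cosine \<open>c\<close>,
  then \<open>r = x / y\<close> and \<open>q = z / y\<close> turn the law of cosines into \<open>q\<^sup>4 = r\<^sup>4 - 2 c r\<^sup>2 + 1\<close>. The area is
  rational iff the sine of the angle is, so \<open>c\<close> and the sine give a rational point on the unit circle,
  and \<open>c = 2 k / (k\<^sup>2 + 1)\<close>. A triangle has at most one non-acute angle, so the angle may be taken
  acute, which is the condition \<open>0 < k < 1\<close>. Conversely, a solution gives a triangle with sides
  \<open>r\<^sup>2\<close>, \<open>1\<close>, \<open>q\<^sup>2\<close> and rational area, and a common denominator is cleared by scaling with a square.
\<close>

lemma dist_real_2_sq:
  fixes A B :: "real ^ 2"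
  shows "(dist A B)\<^sup>2 = (A $ 1 - B $ 1)\<^sup>2 + (A $ 2 - B $ 2)\<^sup>2"
  by (simp add: dist_vec_def dist_real_def L2_set_def UNIV_2)

text \<open>Heron's formula in polynomial form: if the angle at \<open>C\<close> has sine s and
  cosine c, the two squares on the left are the squares of 2abs and 2abc, where a and b are the
  sides meeting at \<open>C\<close>.\<close>

lemma heron_law_of_cosines:
  fixes A B C :: "real ^ 2"
  shows "16 * (measure lborel (convex hull {A, B, C}))\<^sup>2 + ((dist B C)\<^sup>2 + (dist C A)\<^sup>2 - (dist A B)\<^sup>2)\<^sup>2
           = 4 * (dist B C)\<^sup>2 * (dist C A)\<^sup>2"
proof -
  have "16 * (measure lborel (convex hull {A, B, C}))\<^sup>2 =
          4 * ((C $ 1 - A $ 1) * (B $ 2 - A $ 2) - (B $ 1 - A $ 1) * (C $ 2 - A $ 2))\<^sup>2"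
    by (subst content_triangle) (simp add: power_divide)
  then show ?thesis
    unfolding dist_real_2_sq by algebra
qed

lemma collinear_content_0:
  fixes A B C :: "real ^ 2"
  assumes "collinear {A, B, C}"
  shows "measure lborel (convex hull {A, B, C}) = 0"
proof -
  from assms consider "A = C" | u where "B = u *\<^sub>R A + (1 - u) *\<^sub>R C"
    by (auto simp: collinear_3_expand)
  then show ?thesis
  proof cases
    case 2
    show ?thesis
      unfolding content_triangle 2 by (simp add: algebra_simps)
  qed (simp add: content_triangle)
qed

lemma triangle_with_sides_and_area:
  fixes a b c S :: real
  assumes pos: "a > 0" "b > 0" "c > 0" "S > 0"
    and eq: "16 * S\<^sup>2 + (a\<^sup>2 + b\<^sup>2 - c\<^sup>2)\<^sup>2 = 4 * a\<^sup>2 * b\<^sup>2"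
  obtains A B C :: "real ^ 2"
  where "dist B C = a" "dist C A = b" "dist A B = c" "measure lborel (convex hull {A, B, C}) = S"
proof -
  \<comment> \<open>With \<open>C\<close> at the origin and \<open>B\<close> on the first axis, the
    law of cosines gives the first coordinate \<open>x\<close> of \<open>A\<close>, and the area
    gives its height \<open>h\<close>.\<close>
  define x h where "x = (a\<^sup>2 + b\<^sup>2 - c\<^sup>2) / (2 * a)" and "h = 2 * S / a"
  define A B C :: "real ^ 2" where "A = vector [x, h]" and "B = vector [a, 0]" and "C = 0"
  have ax: "2 * a * x = a\<^sup>2 + b\<^sup>2 - c\<^sup>2" and ah: "a * h = 2 * S"
    using pos by (simp_all add: x_def h_def)
  have "4 * a\<^sup>2 * (x\<^sup>2 + h\<^sup>2) = 4 * a\<^sup>2 * b\<^sup>2"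
    using ax ah eq by algebra
  then have b: "x\<^sup>2 + h\<^sup>2 = b\<^sup>2"
    using pos by simp
  have c: "(x - a)\<^sup>2 + h\<^sup>2 = c\<^sup>2"
    using b ax by algebra
  have "(dist B C)\<^sup>2 = a\<^sup>2" "(dist C A)\<^sup>2 = b\<^sup>2" "(dist A B)\<^sup>2 = c\<^sup>2"
    unfolding dist_real_2_sq using b c by (simp_all add: A_def B_def C_def)
  then have "dist B C = a" "dist C A = b" "dist A B = c"
    using pos by (simp_all add: power2_eq_iff_nonneg)
  moreover have "measure lborel (convex hull {A, B, C}) = S"
    using pos ah by (simp add: content_triangle A_def B_def C_def algebra_simps)
  ultimately show ?thesis
    using that by blast
qed

text \<open>Heron's formula for sides \<open>x^2\<close>, \<open>y^2\<close>, \<open>z^2\<close> and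
  area \<open>S\<close>. Stated over the integers, it can be moved both to the reals, for the
  geometry, and to the rationals, for the quartic.\<close>

definition square_sides_area :: "nat \<Rightarrow> nat \<Rightarrow> nat \<Rightarrow> nat \<Rightarrow> bool" where
  "square_sides_area x y z S \<longleftrightarrow> x > 0 \<and> y > 0 \<and> z > 0 \<and> S > 0 \<and>
     16 * (int S)\<^sup>2 + (int x ^ 4 + int y ^ 4 - int z ^ 4)\<^sup>2 = 4 * int x ^ 4 * int y ^ 4"

lemma heron_equation_of_nat_iff:
  fixes x y z S :: nat
  defines "lhs \<equiv> 16 * (of_nat S)\<^sup>2 + (of_nat x ^ 4 + of_nat y ^ 4 - of_nat z ^ 4)\<^sup>2 :: 'a :: {comm_ring_1, ring_char_0}"
  shows "lhs = 4 * of_nat x ^ 4 * of_nat y ^ 4 \<longleftrightarrow>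
     16 * (int S)\<^sup>2 + (int x ^ 4 + int y ^ 4 - int z ^ 4)\<^sup>2 = 4 * int x ^ 4 * int y ^ 4"
proof -
  have "lhs = of_int (16 * (int S)\<^sup>2 + (int x ^ 4 + int y ^ 4 - int z ^ 4)\<^sup>2)"
    by (simp add: lhs_def)
  moreover have "4 * of_nat x ^ 4 * of_nat y ^ 4 = (of_int (4 * int x ^ 4 * int y ^ 4) :: 'a)"
    by simp
  ultimately show ?thesis
    by (simp only: of_int_eq_iff)
qed

text \<open>Expanded, Heron's formula is symmetric in the sides. The swap allows the assumption
  \<open>z \<le> x\<close>.\<close>

lemma square_sides_area_swap:
  assumes "square_sides_area x y z S"
  shows "square_sides_area z y x S"
proof -
  have "16 * (int S)\<^sup>2 + (int z ^ 4 + int y ^ 4 - int x ^ 4)\<^sup>2 = 4 * int z ^ 4 * int y ^ 4"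
    if "16 * (int S)\<^sup>2 + (int x ^ 4 + int y ^ 4 - int z ^ 4)\<^sup>2 = 4 * int x ^ 4 * int y ^ 4"
    using that by algebra
  then show ?thesis
    using assms unfolding square_sides_area_def by blast
qed

lemma heron_triangle_square_sides_iff:
  "(\<exists>A B C :: real ^ 2. heron_triangle A B C \<and>
      dist B C \<in> pos_int_squares \<and> dist C A \<in> pos_int_squares \<and> dist A B \<in> pos_int_squares)
     \<longleftrightarrow> (\<exists>x y z S. square_sides_area x y z S)"
  (is "?L \<longleftrightarrow> ?R")
proof
  assume ?L
  then obtain A B C :: "real ^ 2" and x y z S :: nat
    where d: "dist B C = real (x\<^sup>2)" "dist C A = real (y\<^sup>2)" "dist A B = real (z\<^sup>2)"
      and S: "measure lborel (convex hull {A, B, C}) = real S"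
      and pos: "x > 0" "y > 0" "z > 0" "S > 0"
    unfolding heron_triangle_def pos_ints_def pos_int_squares_def by blast
  have "16 * (real S)\<^sup>2 + (real x ^ 4 + real y ^ 4 - real z ^ 4)\<^sup>2 = 4 * real x ^ 4 * real y ^ 4"
    using heron_law_of_cosines[of A B C] unfolding d S by simp
  then show ?R
    using pos unfolding square_sides_area_def heron_equation_of_nat_iff[where 'a = real] by blast
next
  assume ?R
  then obtain x y z S where *: "square_sides_area x y z S"
    by blast
  then have pos: "x > 0" "y > 0" "z > 0" "S > 0"
    by (simp_all add: square_sides_area_def)
  have "16 * (real S)\<^sup>2 + (real x ^ 4 + real y ^ 4 - real z ^ 4)\<^sup>2 = 4 * real x ^ 4 * real y ^ 4"
    using * unfolding square_sides_area_def heron_equation_of_nat_iff[where 'a = real] by blast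
  then have eq: "16 * (real S)\<^sup>2 + ((real (x\<^sup>2))\<^sup>2 + (real (y\<^sup>2))\<^sup>2 - (real (z\<^sup>2))\<^sup>2)\<^sup>2
                   = 4 * (real (x\<^sup>2))\<^sup>2 * (real (y\<^sup>2))\<^sup>2"
    by simp
  obtain A B C :: "real ^ 2"
    where d: "dist B C = real (x\<^sup>2)" "dist C A = real (y\<^sup>2)" "dist A B = real (z\<^sup>2)"
      and S: "measure lborel (convex hull {A, B, C}) = real S"
    by (rule triangle_with_sides_and_area[OF _ _ _ _ eq]) (use pos in auto)
  \<comment> \<open>A degenerate triangle would have area 0, but \<open>S\<close> is
    positive.\<close>
  have "\<not> collinear {A, B, C}"
    using collinear_content_0[of A B C] S pos by auto
  moreover have "real n \<in> pos_ints" if "n > 0" for n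
    using that by (auto simp: pos_ints_def)
  moreover have "real (n\<^sup>2) \<in> pos_int_squares" if "n > 0" for n
    using that unfolding pos_int_squares_def by blast
  ultimately have "heron_triangle A B C" "dist B C \<in> pos_int_squares"
      "dist C A \<in> pos_int_squares" "dist A B \<in> pos_int_squares"
    unfolding heron_triangle_def d S using pos by (simp_all del: of_nat_power)
  then show ?L
    by blast
qed

text \<open>Half-angle substitution: write \<open>c\<close> and \<open>s\<close> as the sine and
  cosine of an angle strictly between 0 and pi/2. The tangent of its half,
  \<open>c / (1 + s)\<close>, serves as \<open>k\<close>; it lies between 0 and 1.\<close>

lemma rational_circle_parameter:
  fixes c s :: "'a :: linordered_field"
  assumes "c > 0" "s > 0" "c\<^sup>2 + s\<^sup>2 = 1"
  obtains k where "0 < k" "k < 1" "2 * k / (k\<^sup>2 + 1) = c"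
proof
  show "0 < c / (1 + s)"
    using assms by simp
  have "s\<^sup>2 > 0"
    using assms by simp
  then have "c\<^sup>2 < 1\<^sup>2"
    using assms(3) unfolding one_power2 by linarith
  then have "c < 1"
    by (rule power_less_imp_less_base) simp
  then show "c / (1 + s) < 1"
    using assms by simp
  have s: "1 + s \<noteq> 0"
    using assms by linarith
  have "(c / (1 + s))\<^sup>2 + 1 = (c\<^sup>2 + (1 + s)\<^sup>2) / (1 + s)\<^sup>2"
    using s by (simp add: field_simps)
  also have "c\<^sup>2 + (1 + s)\<^sup>2 = 2 * (1 + s)"
    using assms(3) by algebra
  also have "2 * (1 + s) / (1 + s)\<^sup>2 = 2 / (1 + s)"
    using s by (simp add: power2_eq_square del: distrib_left_numeral)
  finally show "2 * (c / (1 + s)) / ((c / (1 + s))\<^sup>2 + 1) = c"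
    using s by simp
qed

lemma quartic_solution_of_acute_angle:
  assumes *: "square_sides_area x y z S" and le: "z \<le> x"
  shows "\<exists>k r q. quartic_solution k r q \<and> 0 < k \<and> k < 1 \<and> r \<noteq> 0"
proof -
  define X Y Z T :: rat where "X = of_nat x" and "Y = of_nat y" and "Z = of_nat z" and "T = of_nat S"
  have pos: "X > 0" "Y > 0" "Z > 0" "T > 0" and "Z \<le> X"
    using * le by (simp_all add: square_sides_area_def X_def Y_def Z_def T_def)
  have eq: "16 * T\<^sup>2 + (X ^ 4 + Y ^ 4 - Z ^ 4)\<^sup>2 = 4 * X ^ 4 * Y ^ 4"
    using * unfolding square_sides_area_def X_def Y_def Z_def T_def heron_equation_of_nat_iff[where 'a = rat] by blast
  \<comment> \<open>Cosine and sine of the angle between the sides \<open>x^2\<close> and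
    \<open>y^2\<close>. Since \<open>z \<le> x\<close>, the opposite side is not longer than
    \<open>x^2\<close>, so this angle is acute.\<close>
  define c s where "c = (X ^ 4 + Y ^ 4 - Z ^ 4) / (2 * X\<^sup>2 * Y\<^sup>2)" and "s = 2 * T / (X\<^sup>2 * Y\<^sup>2)"
  have "Z ^ 4 \<le> X ^ 4"
    using \<open>Z \<le> X\<close> pos by (intro power_mono) auto
  moreover have "Y ^ 4 > 0"
    using pos by simp
  ultimately have "X ^ 4 + Y ^ 4 - Z ^ 4 > 0"
    by linarith
  then have "c > 0"
    using pos by (simp add: c_def)
  moreover have "s > 0"
    using pos by (simp add: s_def)
  moreover have "c\<^sup>2 + s\<^sup>2 = 1"
  proof -
    have "c\<^sup>2 + s\<^sup>2 = (16 * T\<^sup>2 + (X ^ 4 + Y ^ 4 - Z ^ 4)\<^sup>2) / (4 * X ^ 4 * Y ^ 4)"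
      unfolding c_def s_def power_divide power_mult_distrib using pos by (simp add: field_simps)
    then show ?thesis
      using pos by (simp add: eq)
  qed
  ultimately obtain k where k: "0 < k" "k < 1" "2 * k / (k\<^sup>2 + 1) = c"
    by (rule rational_circle_parameter)
  \<comment> \<open>The law of cosines, divided by \<open>Y ^ 4\<close>.\<close>
  have "(Z / Y) ^ 4 = (X / Y) ^ 4 - 2 * c * (X / Y)\<^sup>2 + 1"
    using pos by (simp add: c_def field_simps power_divide)
  then have "quartic_solution k (X / Y) (Z / Y)"
    by (simp add: quartic_solution_def flip: k(3))
  moreover have "X / Y \<noteq> 0"
    using pos by simp
  ultimately show ?thesis
    using k by blast
qed

lemma pos_rat_clear_denominator:
  fixes p :: rat
  assumes "p > 0"
  obtains n m :: nat where "n > 0" "m > 0" "of_nat n * p = of_nat m"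
proof -
  obtain a b where q: "quotient_of p = (a, b)"
    by fastforce
  then have b: "b > 0" and p: "p = of_int a / of_int b"
    by (simp_all add: quotient_of_denom_pos quotient_of_div)
  with assms have a: "a > 0"
    by (simp add: zero_less_divide_iff)
  show ?thesis
  proof
    show "nat b > 0" "nat a > 0"
      using a b by simp_all
    show "of_nat (nat b) * p = of_nat (nat a)"
      using a b by (simp add: p of_nat_nat)
  qed
qed

lemma square_sides_area_of_quartic_solution:
  assumes sol: "quartic_solution k r q" and k: "0 < k" "k < 1" and r: "r \<noteq> 0"
  shows "\<exists>x y z S. square_sides_area x y z S"
proof -
  define c s where "c = 2 * k / (k\<^sup>2 + 1)" and "s = (1 - k\<^sup>2) / (k\<^sup>2 + 1)"
  have k2: "k\<^sup>2 + 1 > 0"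
    by (simp add: add_nonneg_pos)
  have "k\<^sup>2 < 1"
    using k by (simp add: power_less_one_iff)
  then have s: "s > 0"
    using k2 by (simp add: s_def)
  have "(2 * k)\<^sup>2 + (1 - k\<^sup>2)\<^sup>2 = (k\<^sup>2 + 1)\<^sup>2"
    by algebra
  then have cs: "c\<^sup>2 + s\<^sup>2 = 1"
    using k2 by (simp add: c_def s_def power_divide flip: add_divide_distrib)
  have qr: "q ^ 4 = r ^ 4 - 2 * c * r\<^sup>2 + 1"
    using sol by (simp add: quartic_solution_def c_def)
  \<comment> \<open>Completing the square shows that the third side cannot vanish, because
    \<open>s\<close> is positive.\<close>
  have "q ^ 4 = (r\<^sup>2 - c)\<^sup>2 + s\<^sup>2"
    using qr cs by algebra
  then have "q \<noteq> 0"
    using s by (auto simp: add_nonneg_eq_0_iff)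
  obtain n1 u1 :: nat where 1: "n1 > 0" "u1 > 0" "of_nat n1 * \<bar>r\<bar> = of_nat u1"
    using pos_rat_clear_denominator[of "\<bar>r\<bar>"] r by auto
  obtain n2 u2 :: nat where 2: "n2 > 0" "u2 > 0" "of_nat n2 * \<bar>q\<bar> = of_nat u2"
    using pos_rat_clear_denominator[of "\<bar>q\<bar>"] \<open>q \<noteq> 0\<close> by auto
  obtain n3 u3 :: nat where 3: "n3 > 0" "u3 > 0" "of_nat n3 * s = of_nat u3"
    using pos_rat_clear_denominator[of s] s by auto
  \<comment> \<open>Scaling the sides \<open>r^2\<close>, 1, \<open>q^2\<close> by
    \<open>N^2\<close> turns the area \<open>r^2 * s / 2\<close> into
    \<open>x^2 * N^2 * s / 2\<close>. The factors \<open>n1\<close> and \<open>n2\<close> of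
    \<open>N\<close> make \<open>x\<close> and \<open>z\<close> integers; 2 and \<open>n3\<close>
    make the area an integer.\<close>
  define N x z where "N = 2 * n1 * n2 * n3" and "x = 2 * u1 * n2 * n3" and "z = 2 * n1 * u2 * n3"
  define S where "S = x\<^sup>2 * (n1 * n2) * N * u3"
  have X: "of_nat x = of_nat N * \<bar>r\<bar>" and Z: "of_nat z = of_nat N * \<bar>q\<bar>"
    by (simp_all add: N_def x_def z_def flip: 1(3) 2(3))
  have S: "2 * of_nat S = (of_nat x)\<^sup>2 * (of_nat N)\<^sup>2 * s"
    by (simp add: S_def N_def power2_eq_square flip: 3(3))
  have "16 * (of_nat S)\<^sup>2 + ((of_nat x :: rat) ^ 4 + of_nat N ^ 4 - of_nat z ^ 4)\<^sup>2
          = 4 * (2 * of_nat S)\<^sup>2 + ((of_nat N * \<bar>r\<bar>) ^ 4 + of_nat N ^ 4 - (of_nat N * \<bar>q\<bar>) ^ 4)\<^sup>2"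
    unfolding X Z by (simp add: power_mult_distrib)
  also have "\<dots> = 4 * (of_nat N ^ 4 * r\<^sup>2 * s)\<^sup>2 + (of_nat N ^ 4 * (r ^ 4 + 1 - q ^ 4))\<^sup>2"
    unfolding S X by (simp add: power_mult_distrib algebra_simps)
  \<comment> \<open>By \<open>qr\<close>, the factor \<open>r ^ 4 + 1 - q ^ 4\<close> is
    \<open>2 * c * r^2\<close>, so both summands share the factor
    \<open>4 * N^8 * r^4\<close>.\<close>
  also have "\<dots> = 4 * of_nat N ^ 8 * r ^ 4 * (c\<^sup>2 + s\<^sup>2)"
    unfolding qr by algebra
  also have "\<dots> = 4 * (of_nat N * \<bar>r\<bar>) ^ 4 * of_nat N ^ 4"
    unfolding cs by (simp add: power_mult_distrib)
  also have "\<dots> = 4 * of_nat x ^ 4 * of_nat N ^ 4"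
    unfolding X ..
  finally have "square_sides_area x N z S"
    unfolding heron_equation_of_nat_iff[where 'a = rat] square_sides_area_def
    using 1 2 3 by (simp add: N_def x_def z_def S_def)
  then show ?thesis
    by blast
qed

theorem theorem1p1:
  shows "(\<exists>A B C :: real ^ 2. heron_triangle A B C \<and>
            dist B C \<in> pos_int_squares \<and> dist C A \<in> pos_int_squares \<and> dist A B \<in> pos_int_squares)
     \<longleftrightarrow> (\<exists>k r q :: rat. quartic_solution k r q \<and> \<not> trivial_solution k r q \<and>
            0 < k \<and> k < 1 \<and> r \<noteq> 0)"
  unfolding heron_triangle_square_sides_iff trivial_solution_def
  \<comment> \<open>Either \<open>z \<le> x\<close> already holds, or it holds after exchanging
    \<open>x\<close> and \<open>z\<close>.\<close>
  using square_sides_area_swap quartic_solution_of_acute_angle square_sides_area_of_quartic_solution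
  by (metis nat_le_linear)

end
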